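(* Let $d\ge 1$ and let $\mathbf{s}=(s_1,\ldots,s_d)$ be a sequence of positive integers such that $s_1=\cdots=s_i$ for some $1\le i\le d$, and $s_j<s_{j+1}$ for all $i\le j\le d-1$. Suppose that $\mathbf{P}_d^{(\mathbf{s})}$ is translation equivalent to a Fano polytope. Then $\mathbf{P}_d^{(\mathbf{s})}$ is reflexive up to translation if and only if for all $i\le j\le d-1$ one has $k_j\mid s_j$ and $k_j\mid s_{j+1}$, where $k_j=s_{j+1}-s_j$.
   Context: For a sequence of positive integers $\mathbf{s}=(s_1,\ldots,s_d)$, the $\mathbf{s}$-lecture hall polytope is $\mathbf{P}_d^{(\mathbf{s})}=\{\mathbf{x}\in\mathbb{R}^d : 0\le \frac{x_1}{s_1}\le\frac{x_2}{s_2}\le\cdots\le\frac{x_d}{s_d}\le 1\}$, a $d$-dimensional lattice polytope. A $d$-dimensional lattice polytope $\mathcal{P}\subset\mathbb{R}^d$ is Fano if $(\mathcal{P}\setminus\partial\mathcal{P})\cap\mathbb{Z}^d=\{\mathbf{0}\}$. It is reflexive if it is Fano and its dual polytope $\mathcal{P}^\vee=\{y\in\mathbb{R}^d : \langle x,y\rangle\le 1 \text{ for all } x\in\mathcal{P}\}$ is a lattice polytope. Two lattice polytopes are translation equivalent if one is the translate of the other by a vector in $\mathbb{Z}^d$; "reflexive up to translation" means translation equivalent to a reflexive polytope. *)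

theory Defs
  imports "HOL-Analysis.Analysis"
begin

text \<open>
  Throughout, \<open>\<real>\<^sup>d\<close> is \<^typ>\<open>real ^ 'n\<close> with \<open>d = CARD('n)\<close>. The linear order on the finite index
  type only serves to say which coordinate is the first, the second, and so on: \<open>idx k\<close> is the
  \<open>k\<close>-th smallest index, for \<open>1 \<le> k \<le> d\<close>, so the coordinate \<open>x\<^sub>k\<close> is \<open>x $ idx k\<close>. Sequences
  \<open>(s\<^sub>1, \<dots>, s\<^sub>d)\<close> are functions on \<^typ>\<open>nat\<close> of which only the values on \<open>{1..d}\<close> matter.
\<close>

definition idx :: "nat \<Rightarrow> 'n::{finite,linorder}" where
  "idx k = sorted_list_of_set UNIV ! (k - 1)"

lemma bij_betw_idx:
  "bij_betw (idx :: nat \<Rightarrow> 'n::{finite,linorder}) {1..CARD('n)} UNIV"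
proof -
  have "bij_betw (\<lambda>k. k - 1) {1..CARD('n)} {..<CARD('n)}"
    by (rule bij_betwI[where g = Suc]) auto
  moreover have "bij_betw ((!) (sorted_list_of_set (UNIV :: 'n set))) {..<CARD('n)} UNIV"
    by (rule bij_betw_nth) auto
  ultimately show ?thesis
    by (auto dest: bij_betw_trans simp: idx_def[abs_def] o_def)
qed

lemma idx_less:
  assumes "1 \<le> j" "j < k" "k \<le> CARD('n)"
  shows "(idx j :: 'n::{finite,linorder}) < idx k"
  unfolding idx_def
  by (rule sorted_wrt_nth_less[OF strict_sorted_list_of_set]) (use assms in auto)

definition lecture_hall_polytope :: "(nat \<Rightarrow> nat) \<Rightarrow> (real ^ 'n::{finite,linorder}) set" where
  "lecture_hall_polytope s =
     {x. 0 \<le> x $ idx 1 / real (s 1)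
       \<and> (\<forall>j. 1 \<le> j \<and> j < CARD('n) \<longrightarrow>
             x $ idx j / real (s j) \<le> x $ idx (j + 1) / real (s (j + 1)))
       \<and> x $ idx CARD('n) / real (s CARD('n)) \<le> 1}"

definition integer_lattice :: "(real ^ 'n) set" where
  "integer_lattice = {x. \<forall>i. x $ i \<in> \<int>}"

definition lattice_polytope :: "(real ^ 'n) set \<Rightarrow> bool" where
  "lattice_polytope P \<longleftrightarrow> (\<exists>V. finite V \<and> V \<subseteq> integer_lattice \<and> P = convex hull V)"

definition fano :: "(real ^ 'n) set \<Rightarrow> bool" where
  "fano P \<longleftrightarrow> lattice_polytope P \<and> aff_dim P = int CARD('n)
     \<and> (P - frontier P) \<inter> integer_lattice = {0}"

definition dual_polytope :: "(real ^ 'n) set \<Rightarrow> (real ^ 'n) set" where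
  "dual_polytope P = {y. \<forall>x\<in>P. x \<bullet> y \<le> 1}"

definition reflexive :: "(real ^ 'n) set \<Rightarrow> bool" where
  "reflexive P \<longleftrightarrow> fano P \<and> lattice_polytope (dual_polytope P)"

definition translation_equivalent :: "(real ^ 'n) set \<Rightarrow> (real ^ 'n) set \<Rightarrow> bool" where
  "translation_equivalent P Q \<longleftrightarrow> lattice_polytope P \<and> lattice_polytope Q
     \<and> (\<exists>v\<in>integer_lattice. Q = (+) v ` P)"

definition reflexive_up_to_translation :: "(real ^ 'n) set \<Rightarrow> bool" where
  "reflexive_up_to_translation P \<longleftrightarrow> (\<exists>Q. reflexive Q \<and> translation_equivalent P Q)"

end

theory Submission
  imports Defs
begin

text \<open>
  Let \<open>p\<close> be the point with \<open>p\<^sub>j = j\<close> for \<open>j \<le> i\<close> and \<open>p\<^sub>j = s\<^sub>j - 1\<close> for \<open>j > i\<close>. If the polytope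
  has an interior lattice point at all, then \<open>s\<^sub>1 > i\<close> and \<open>p\<close> is an interior lattice point, and so
  is the point obtained by replacing the first \<open>i\<close> entries by \<open>s\<^sub>1 - i, \<dots>, s\<^sub>1 - 1\<close>. The interior
  lattice point being unique, \<open>s\<^sub>1 = i + 1\<close>, and the only translate that can be Fano is the one by
  \<open>-p\<close>. Its dual is the simplex spanned by the facet normals divided by the distances
  \<open>s\<^sub>j p\<^bsub>j+1\<^esub> - s\<^bsub>j+1\<^esub> p\<^sub>j\<close> of \<open>p\<close> from the facets. For \<open>j \<ge> i\<close> this distance is \<open>k\<^sub>j\<close>, hence the
  \<open>j\<close>-th vertex is \<open>(s\<^bsub>j+1\<^esub> e\<^sub>j - s\<^sub>j e\<^bsub>j+1\<^esub>) / k\<^sub>j\<close>; all other vertices are lattice points.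
\<close>

section \<open>Finite intersections of half-spaces: interiors, duals and integral vertices\<close>

text \<open>An open subset of the intersection lies in the interior of each closed half-space, which
  is the open half-space because the normal is nonzero. Finiteness keeps the intersection of the
  open half-spaces open.\<close>

lemma interior_halfspaces_le:
  fixes a :: "'b \<Rightarrow> 'a::euclidean_space"
  assumes "finite J" "\<And>j. j \<in> J \<Longrightarrow> a j \<noteq> 0"
  shows "interior {x. \<forall>j\<in>J. a j \<bullet> x \<le> b j} = {x. \<forall>j\<in>J. a j \<bullet> x < b j}"
proof (rule interior_unique)
  have "{x. \<forall>j\<in>J. a j \<bullet> x < b j} = (\<Inter>j\<in>J. {x. a j \<bullet> x < b j})"
    by auto
  then show "open {x. \<forall>j\<in>J. a j \<bullet> x < b j}"
    using assms(1) by (simp add: open_INT open_halfspace_lt)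
next
  fix T assume T: "T \<subseteq> {x. \<forall>j\<in>J. a j \<bullet> x \<le> b j}" "open T"
  have "T \<subseteq> {x. a j \<bullet> x < b j}" if "j \<in> J" for j
  proof -
    have "T \<subseteq> interior {x. a j \<bullet> x \<le> b j}"
      using T that by (intro interior_maximal) auto
    then show ?thesis
      using assms(2)[OF that] by simp
  qed
  then show "T \<subseteq> {x. \<forall>j\<in>J. a j \<bullet> x < b j}"
    by auto
qed (auto intro: less_imp_le)

text \<open>\<open>no_neg\<close> is the dual form of 0 lying in the convex hull. A dual point
  outside the hull could be separated from it, and a rescaled normal of the separating hyperplane
  would be a point of the polyhedron violating the dual inequality.\<close>

lemma dual_polytope_halfspaces:
  fixes u :: "'b \<Rightarrow> real ^ 'n"
  assumes "finite J" and no_neg: "\<And>z. \<exists>j\<in>J. 0 \<le> u j \<bullet> z"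
  shows "dual_polytope {x. \<forall>j\<in>J. u j \<bullet> x \<le> 1} = convex hull (u ` J)" (is "dual_polytope ?Q = ?C")
proof
  show "?C \<subseteq> dual_polytope ?Q"
  proof (rule hull_minimal)
    show "u ` J \<subseteq> dual_polytope ?Q"
      by (auto simp: dual_polytope_def inner_commute)
    have "dual_polytope ?Q = (\<Inter>x\<in>?Q. {y. x \<bullet> y \<le> 1})"
      by (auto simp: dual_polytope_def)
    then show "convex (dual_polytope ?Q)"
      by (simp add: convex_INT convex_halfspace_le)
  qed
next
  show "dual_polytope ?Q \<subseteq> ?C"
  proof
    fix y assume y: "y \<in> dual_polytope ?Q"
    show "y \<in> ?C"
    proof (rule ccontr)
      assume "y \<notin> ?C"
      moreover have "closed ?C"
        using assms(1) by (simp add: compact_convex_hull compact_imp_closed finite_imp_compact)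
      ultimately obtain z b where z: "z \<bullet> y < b" "\<And>x. x \<in> ?C \<Longrightarrow> b < z \<bullet> x"
        using separating_hyperplane_closed_point[of ?C y] convex_convex_hull by blast
      have u: "b < z \<bullet> u j" if "j \<in> J" for j
        using z(2) that by (simp add: hull_inc)
      \<comment> \<open>The hull lies on the upper side of the hyperplane, so \<open>no_neg\<close>
        is used at \<open>- z\<close>: some \<open>z \<bullet> u j\<close> is at most 0 and yet
        exceeds \<open>b\<close>.\<close>
      obtain j where j: "j \<in> J" "0 \<le> u j \<bullet> (- z)"
        using no_neg by blast
      then have "b < 0"
        using u[OF j(1)] by (simp add: inner_commute)
      \<comment> \<open>Dividing by the negative \<open>b\<close> reverses the inequalities: the
        values on the \<open>u j\<close> drop below 1, while the value on \<open>y\<close> exceeds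
        1.\<close>
      then have "(1 / b) *\<^sub>R z \<in> ?Q"
        using u by (auto simp: divide_simps inner_commute intro: less_imp_le)
      then have "((1 / b) *\<^sub>R z) \<bullet> y \<le> 1"
        using y unfolding dual_polytope_def by blast
      then show False
        using z(1) \<open>b < 0\<close> by (simp add: divide_simps)
    qed
  qed
qed

text \<open>By \<open>sep\<close> no \<open>u j\<close> lies in the hull of the others, so each is
  an extreme point; extreme points of a hull belong to every generating set, in particular to an
  integral one.\<close>

lemma lattice_polytope_convex_hull_iff:
  fixes u :: "'b \<Rightarrow> real ^ 'n"
  assumes "finite J"
    and sep: "\<And>j. j \<in> J \<Longrightarrow> \<exists>z. 0 < u j \<bullet> z \<and> (\<forall>l\<in>J - {j}. u l \<bullet> z \<le> 0)"
  shows "lattice_polytope (convex hull (u ` J)) \<longleftrightarrow> u ` J \<subseteq> integer_lattice"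
proof
  assume "lattice_polytope (convex hull (u ` J))"
  then obtain V where V: "finite V" "V \<subseteq> integer_lattice" "convex hull (u ` J) = convex hull V"
    by (auto simp: lattice_polytope_def)
  show "u ` J \<subseteq> integer_lattice"
  proof clarify
    fix j assume j: "j \<in> J"
    obtain z where z: "0 < u j \<bullet> z" "\<forall>l\<in>J - {j}. u l \<bullet> z \<le> 0"
      using sep[OF j] by blast
    have "convex hull (u ` (J - {j})) \<subseteq> {y. z \<bullet> y \<le> 0}"
      using z(2) by (intro hull_minimal convex_halfspace_le) (auto simp: inner_commute)
    with z(1) have "u j \<notin> convex hull (u ` (J - {j}))"
      by (auto simp: inner_commute)
    then have "u j extreme_point_of convex hull (insert (u j) (u ` (J - {j})))"
      using assms(1) by (intro extreme_point_of_convex_hull_insert) auto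
    moreover have "insert (u j) (u ` (J - {j})) = u ` J"
      using j by auto
    ultimately have "u j \<in> V"
      using V(3) extreme_point_of_convex_hull by metis
    then show "u j \<in> integer_lattice"
      using V(2) by blast
  qed
next
  assume "u ` J \<subseteq> integer_lattice"
  then show "lattice_polytope (convex hull (u ` J))"
    using assms(1) by (auto simp: lattice_polytope_def)
qed

text \<open>Translation by a lattice vector respects both the interior and the lattice, so the
  unique interior lattice point 0 pulls back to \<open>- v\<close>.\<close>

lemma fano_translate_interior:
  fixes P :: "(real ^ 'n) set"
  assumes "fano ((+) v ` P)" "v \<in> integer_lattice"
  shows "interior P \<inter> integer_lattice = {- v}"
proof -
  have shift: "x \<in> interior P \<longleftrightarrow> v + x \<in> interior ((+) v ` P)" for x
    by (auto simp: interior_translation)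
  have "S - frontier S = interior S" for S :: "(real ^ 'n) set"
    using interior_subset closure_subset by (auto simp: frontier_def)
  then have Q: "interior ((+) v ` P) \<inter> integer_lattice = {0}"
    using assms(1) by (simp add: fano_def)
  have lat: "v + x \<in> integer_lattice \<longleftrightarrow> x \<in> integer_lattice" for x
    using assms(2) Ints_diff by (fastforce simp: integer_lattice_def)
  have "x \<in> interior P \<inter> integer_lattice \<longleftrightarrow> v + x = 0" for x
    using shift[of x] lat[of x] Q by (auto simp: set_eq_iff)
  then show ?thesis
    by (simp add: set_eq_iff eq_neg_iff_add_eq_0 add.commute)
qed

section \<open>Coordinates, facets and interior of the lecture hall polytope\<close>

definition of_seq :: "(nat \<Rightarrow> real) \<Rightarrow> real ^ 'n::{finite,linorder}" where
  "of_seq f = (\<chi> n. f (the_inv_into {1..CARD('n)} idx n))"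

lemma of_seq_idx [simp]:
  assumes "1 \<le> k" "k \<le> CARD('n)"
  shows "of_seq f $ (idx k :: 'n::{finite,linorder}) = f k"
  using bij_betw_idx[where 'n = 'n] assms
  by (simp add: of_seq_def the_inv_into_f_f bij_betw_def)

lemma of_seq_in_integer_lattice:
  assumes "\<And>k. f k \<in> \<int>"
  shows "of_seq f \<in> integer_lattice"
  using assms by (simp add: integer_lattice_def of_seq_def)

text \<open>Outer normals of the facets, with denominators cleared to make them integral. Index 0
  stands for the lower bound on the first coordinate and index \<open>CARD('n)\<close> for the upper
  bound on the last one.\<close>

definition facet_normal :: "(nat \<Rightarrow> nat) \<Rightarrow> nat \<Rightarrow> real ^ 'n::{finite,linorder}" where
  "facet_normal s j =
     (if j = 0 then - axis (idx 1) 1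
      else if j = CARD('n) then axis (idx j) 1
      else real (s (j + 1)) *\<^sub>R axis (idx j) 1 - real (s j) *\<^sub>R axis (idx (j + 1)) 1)"

lemma inner_facet_normal:
  fixes x :: "real ^ 'n::{finite,linorder}"
  shows "facet_normal s j \<bullet> x =
     (if j = 0 then - x $ idx 1
      else if j = CARD('n) then x $ idx j
      else real (s (j + 1)) * x $ idx j - real (s j) * x $ idx (j + 1))"
  by (simp add: facet_normal_def inner_axis' inner_diff_left)

lemma lecture_hall_polytope_halfspaces:
  assumes pos: "\<forall>j. 1 \<le> j \<and> j \<le> CARD('n) \<longrightarrow> 0 < s j"
  shows "lecture_hall_polytope s =
    {x :: real ^ 'n::{finite,linorder}. \<forall>j\<in>{..CARD('n)}.
        facet_normal s j \<bullet> x \<le> (if j = CARD('n) then real (s j) else 0)}"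
    (is "_ = ?R")
proof (rule set_eqI)
  fix x :: "(real, 'n) vec"
  have d: "1 \<le> CARD('n)" "0 < CARD('n)"
    by (simp_all add: Suc_leI)
  have "0 < s 1" "0 < s CARD('n)"
    using pos d by auto
  then have first: "0 \<le> x $ idx 1 / real (s 1) \<longleftrightarrow> 0 \<le> x $ idx 1"
    by (simp add: zero_le_divide_iff)
  have last: "x $ idx CARD('n) / real (s CARD('n)) \<le> 1 \<longleftrightarrow> x $ idx CARD('n) \<le> real (s CARD('n))"
    using \<open>0 < s CARD('n)\<close> by (simp add: pos_divide_le_eq)
  have mid: "x $ idx j / real (s j) \<le> x $ idx (j + 1) / real (s (j + 1)) \<longleftrightarrow>
      real (s (j + 1)) * x $ idx j - real (s j) * x $ idx (j + 1) \<le> 0"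
    if "1 \<le> j \<and> j < CARD('n)" for j
  proof -
    have "0 < real (s j)" "0 < real (s (j + 1))"
      using pos that by auto
    then show ?thesis
      by (simp add: field_simps)
  qed
  have split: "{..CARD('n)} = insert 0 (insert CARD('n) {1..<CARD('n)})"
    by auto
  show "x \<in> lecture_hall_polytope s \<longleftrightarrow> x \<in> ?R"
    unfolding lecture_hall_polytope_def split
    using first last mid by (auto simp: inner_facet_normal)
qed

lemma facet_normal_nonzero:
  assumes pos: "\<forall>j. 1 \<le> j \<and> j \<le> CARD('n) \<longrightarrow> 0 < s j" and "j \<le> CARD('n)"
  shows "(facet_normal s j :: real ^ 'n::{finite,linorder}) \<noteq> 0"
proof -
  \<comment> \<open>A 0/1 vector dropping to 0 right after position \<open>j\<close>; the
    \<open>max\<close> keeps its first entry equal to 1 when \<open>j = 0\<close>.\<close>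
  define x :: "(real, 'n) vec" where "x = of_seq (\<lambda>k. if k \<le> max 1 j then 1 else 0)"
  have "facet_normal s j \<bullet> x \<noteq> 0"
    using assms by (auto simp: inner_facet_normal x_def Suc_le_eq)
  then show ?thesis
    by auto
qed

text \<open>Provides the \<open>sep\<close> condition, so that no facet yields a redundant vertex of
  the dual.\<close>

lemma facet_normal_separating:
  assumes pos: "\<forall>j. 1 \<le> j \<and> j \<le> CARD('n) \<longrightarrow> 0 < s j" and "j \<le> CARD('n)"
  shows "\<exists>z :: real ^ 'n::{finite,linorder}. 0 < facet_normal s j \<bullet> z \<and>
    (\<forall>l\<in>{..CARD('n)} - {j}. facet_normal s l \<bullet> z \<le> 0)"
proof -
  \<comment> \<open>The vector \<open>s\<close> is orthogonal to all normals except the first and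
    the last. Truncating it after \<open>j\<close> makes just the \<open>j\<close>-th value
    positive; for \<open>j = 0\<close> the sign is flipped instead.\<close>
  define z :: "(real, 'n) vec" where
    "z = of_seq (\<lambda>k. if j = 0 then - real (s k) else if k \<le> j then real (s k) else 0)"
  have "0 < facet_normal s j \<bullet> z"
    using assms by (auto simp: inner_facet_normal z_def Suc_le_eq)
  moreover have "facet_normal s l \<bullet> z \<le> 0" if "l \<le> CARD('n)" "l \<noteq> j" for l
    using that assms by (auto simp: inner_facet_normal z_def Suc_le_eq)
  ultimately show ?thesis
    by blast
qed

text \<open>Provides \<open>no_neg\<close>. Negative values would make the first coordinate
  positive, positivity would propagate up to the last coordinate, and there the last normal
  contradicts it.\<close>

lemma facet_normal_not_all_neg:
  fixes z :: "real ^ 'n::{finite,linorder}"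
  assumes pos: "\<forall>j. 1 \<le> j \<and> j \<le> CARD('n) \<longrightarrow> 0 < s j"
  shows "\<exists>j\<in>{..CARD('n)}. 0 \<le> facet_normal s j \<bullet> z"
proof (rule ccontr)
  assume "\<not> ?thesis"
  then have neg: "facet_normal s j \<bullet> z < 0" if "j \<le> CARD('n)" for j
    using that by (simp add: not_le)
  have "1 \<le> k \<Longrightarrow> k \<le> CARD('n) \<Longrightarrow> 0 < z $ idx k" for k
  proof (induction k rule: dec_induct)
    case base
    then show ?case
      using neg[of 0] by (simp add: inner_facet_normal)
  next
    case (step k)
    then have "real (s (k + 1)) * z $ idx k < real (s k) * z $ idx (k + 1)"
      using neg[of k] by (simp add: inner_facet_normal)
    moreover have "0 < real (s (k + 1)) * z $ idx k"
      using step pos by simp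
    ultimately have "0 < real (s k) * z $ idx (k + 1)"
      by linarith
    then show ?case
      by (simp add: zero_less_mult_iff)
  qed
  from this[of "CARD('n)"] neg[of "CARD('n)"] show False
    by (simp add: inner_facet_normal Suc_le_eq)
qed

lemma interior_lecture_hall_polytope:
  assumes pos: "\<forall>j. 1 \<le> j \<and> j \<le> CARD('n) \<longrightarrow> 0 < s j"
  shows "interior (lecture_hall_polytope s) =
    {x :: real ^ 'n::{finite,linorder}. \<forall>j\<in>{..CARD('n)}.
        facet_normal s j \<bullet> x < (if j = CARD('n) then real (s j) else 0)}"
  unfolding lecture_hall_polytope_halfspaces[OF pos]
  using facet_normal_nonzero[OF pos] by (intro interior_halfspaces_le) auto

text \<open>The bound holds at the last coordinate and descends from there, since the ratios
  \<open>x $ idx j / s j\<close> increase strictly in the interior.\<close>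

lemma lecture_hall_interior_less:
  fixes x :: "real ^ 'n::{finite,linorder}"
  assumes pos: "\<forall>j. 1 \<le> j \<and> j \<le> CARD('n) \<longrightarrow> 0 < s j"
    and x: "x \<in> interior (lecture_hall_polytope s)"
    and j: "1 \<le> j" "j \<le> CARD('n)"
  shows "x $ idx j < real (s j)"
  using j(2,1)
proof (induction j rule: inc_induct)
  case base
  then show ?case
    using x by (force simp: interior_lecture_hall_polytope[OF pos] inner_facet_normal)
next
  case (step j)
  have "\<forall>j\<in>{..CARD('n)}. facet_normal s j \<bullet> x < (if j = CARD('n) then real (s j) else 0)"
    using x by (simp add: interior_lecture_hall_polytope[OF pos])
  from bspec[OF this, of j] have "real (s (j + 1)) * x $ idx j < real (s j) * x $ idx (j + 1)"
    using step by (simp add: inner_facet_normal)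
  also have "\<dots> \<le> real (s j) * real (s (j + 1))"
    using step by (intro mult_left_mono) auto
  finally have "real (s (j + 1)) * x $ idx j < real (s (j + 1)) * real (s j)"
    by (simp add: mult.commute)
  then show ?case
    using mult_less_cancel_left_pos[of "real (s (j + 1))"] pos step by auto
qed

text \<open>
  The interior lattice points used in the argument: \<open>t = 1\<close> gives \<open>p\<close>, and \<open>t = s\<^sub>1 - i\<close> gives
  its competitor.
\<close>

definition stair :: "(nat \<Rightarrow> nat) \<Rightarrow> nat \<Rightarrow> nat \<Rightarrow> real ^ 'n::{finite,linorder}" where
  "stair s i t = of_seq (\<lambda>k. if k \<le> i then real t + real k - 1 else real (s k) - 1)"

lemma stair_idx:
  assumes "1 \<le> k" "k \<le> CARD('n)"
  shows "stair s i t $ (idx k :: 'n::{finite,linorder}) =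
    (if k \<le> i then real t + real k - 1 else real (s k) - 1)"
  using assms by (simp add: stair_def)

lemma stair_in_integer_lattice: "stair s i t \<in> integer_lattice"
  unfolding stair_def by (intro of_seq_in_integer_lattice) auto

section \<open>Interior lattice points and the only possible Fano translate\<close>

context
  fixes s :: "nat \<Rightarrow> nat" and i :: nat
  assumes pos: "\<forall>j. 1 \<le> j \<and> j \<le> CARD('n::{finite,linorder}) \<longrightarrow> 0 < s j"
    and i: "1 \<le> i" "i \<le> CARD('n)"
    and const: "\<forall>j. 1 \<le> j \<and> j \<le> i \<longrightarrow> s j = s 1"
    and incr: "\<forall>j. i \<le> j \<and> j < CARD('n) \<longrightarrow> s j < s (j + 1)"
begin

lemma s_const: "s j = s 1" if "1 \<le> j" "j \<le> i"
  using const that by blast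

text \<open>The first \<open>i\<close> entries \<open>t, ..., t + i - 1\<close> increase strictly
  between 0 and \<open>s 1\<close>. Past them, \<open>(s j - 1) / s j\<close> increases with
  \<open>s j\<close>.\<close>

lemma stair_interior:
  assumes t: "1 \<le> t" "t + i \<le> s 1"
  shows "(stair s i t :: (real, 'n) vec) \<in> interior (lecture_hall_polytope s)"
proof -
  have "facet_normal s j \<bullet> (stair s i t :: (real, 'n) vec) < (if j = CARD('n) then real (s j) else 0)"
    if j: "j \<le> CARD('n)" for j
  proof -
    consider "j = 0" | "j = CARD('n)" "j \<noteq> 0" | "j \<noteq> 0" "j < i" "j < CARD('n)" | "j = i" "j < CARD('n)" | "j > i" "j < CARD('n)"
      using j by atomize_elim auto
    then show ?thesis
    proof cases
      case 1
      then show ?thesis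
        using i t by (simp add: inner_facet_normal stair_idx)
    next
      case 2
      then show ?thesis
        using i t s_const[of j] by (auto simp: inner_facet_normal stair_idx)
    next
      case 3
      have "s j = s 1" "s (j + 1) = s 1" "0 < s 1"
        using 3 s_const[of j] s_const[of "j + 1"] pos i by auto
      then show ?thesis
        using 3 by (simp add: inner_facet_normal stair_idx algebra_simps)
    next
      case 4
      have *: "real t + real i - 1 \<le> real (s i) - 1" "real (s i) < real (s (i + 1))"
        using 4 s_const[of i] i incr t by (auto simp flip: of_nat_add)
      \<comment> \<open>At the junction the \<open>i\<close>-th entry is at most
        \<open>s i - 1\<close>, which reduces this facet to the computation for
        \<open>j > i\<close>.\<close>
      have "real (s (i + 1)) * (real t + real i - 1) \<le> real (s (i + 1)) * (real (s i) - 1)"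
        using * by (intro mult_left_mono) auto
      also have "\<dots> < real (s i) * (real (s (i + 1)) - 1)"
        using * by (simp add: algebra_simps)
      finally show ?thesis
        using 4 i by (simp add: inner_facet_normal stair_idx)
    next
      case 5
      then have "real (s j) < real (s (j + 1))"
        using incr by simp
      then show ?thesis
        using 5 by (simp add: inner_facet_normal stair_idx algebra_simps)
    qed
  qed
  then show ?thesis
    by (simp add: interior_lecture_hall_polytope[OF pos])
qed

text \<open>On the constant stretch the coordinates are strictly increasing positive integers, so
  the \<open>i\<close>-th one is at least \<open>i\<close>, and it is also below
  \<open>s i = s 1\<close>.\<close>

lemma interior_lattice_point_imp_less:
  fixes x :: "(real, 'n) vec"
  assumes x: "x \<in> interior (lecture_hall_polytope s)" "x \<in> integer_lattice"
  shows "i < s 1"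
proof -
  have facet: "facet_normal s j \<bullet> x < (if j = CARD('n) then real (s j) else 0)" if "j \<le> CARD('n)" for j
    using x(1) that by (auto simp: interior_lecture_hall_polytope[OF pos])
  have "1 \<le> k \<Longrightarrow> k \<le> i \<Longrightarrow> real k \<le> x $ idx k" for k
  proof (induction k rule: dec_induct)
    case base
    have "0 < x $ idx 1"
      using facet[of 0] i by (simp add: inner_facet_normal)
    moreover obtain m where "x $ idx 1 = of_int m"
      using x(2) by (auto simp: integer_lattice_def elim: Ints_cases)
    ultimately show ?case
      by simp
  next
    case (step k)
    have "s k = s 1" "s (k + 1) = s 1" "0 < s 1"
      using step s_const[of k] s_const[of "k + 1"] pos i by auto
    then have "x $ idx k < x $ idx (k + 1)"
      using facet[of k] step i by (simp add: inner_facet_normal)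
    moreover obtain l m where "x $ idx k = of_int l" "x $ idx (k + 1) = of_int m"
      using x(2) unfolding integer_lattice_def by (blast elim: Ints_cases)
    ultimately have "x $ idx k + 1 \<le> x $ idx (k + 1)"
      by simp
    then show ?case
      using step by simp
  qed
  then have "real i \<le> x $ idx i"
    using i by simp
  also have "\<dots> < real (s i)"
    using lecture_hall_interior_less[OF pos x(1)] i by simp
  finally show ?thesis
    using s_const[of i] i by simp
qed

lemma fano_translate_lecture_hall:
  assumes v: "v \<in> integer_lattice"
    and fano: "fano ((+) v ` (lecture_hall_polytope s :: (real, 'n) vec set))"
  shows "v = - stair s i 1" "s 1 = i + 1"
proof -
  let ?P = "lecture_hall_polytope s :: (real, 'n) vec set"
  have int: "interior ?P \<inter> integer_lattice = {- v}"
    by (rule fano_translate_interior[OF fano v])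
  then have less: "i < s 1"
    using interior_lattice_point_imp_less[of "- v"] by blast
  then have eq: "stair s i t = - v" if "1 \<le> t" "t + i \<le> s 1" for t
    using stair_interior[OF that] stair_in_integer_lattice[of s i t] int by blast
  show "v = - stair s i 1"
    using eq[of 1] less by simp
  have "stair s i (s 1 - i) = - v"
    using less by (intro eq) auto
  moreover have "stair s i 1 = - v"
    using less by (intro eq) auto
  \<comment> \<open>The first entries of the two coinciding points are 1 and
    \<open>s 1 - i\<close>.\<close>
  ultimately have "(stair s i 1 :: (real, 'n) vec) $ idx 1 = (stair s i (s 1 - i) :: (real, 'n) vec) $ idx 1"
    by simp
  then show "s 1 = i + 1"
    using i less by (simp add: stair_idx of_nat_diff)
qed

section \<open>The vertices of the dual simplex and their integrality\<close>

text \<open>The scaling turns the \<open>j\<close>-th facet inequality of the polytope translated by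
  \<open>- stair s i 1\<close> into one with right-hand side 1.\<close>

definition dual_vertex :: "nat \<Rightarrow> (real, 'n) vec" where
  "dual_vertex j =
    facet_normal s j /\<^sub>R ((if j = CARD('n) then real (s j) else 0) - facet_normal s j \<bullet> (stair s i 1 :: (real, 'n) vec))"

text \<open>The hypothesis puts \<open>stair s i 1\<close> in the interior, so all the divisors are
  positive and the sign conditions on the normals carry over to the scaled normals. The dual is then
  their hull, and each of them is extreme.\<close>

lemma lattice_dual_lecture_hall_iff:
  assumes less: "i < s 1"
  shows "lattice_polytope (dual_polytope ((+) (- stair s i 1) ` lecture_hall_polytope s :: (real, 'n) vec set))
    \<longleftrightarrow> (\<forall>j\<le>CARD('n). dual_vertex j \<in> integer_lattice)"
proof -
  define p :: "(real, 'n) vec" where "p = stair s i 1"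
  define a :: "nat \<Rightarrow> (real, 'n) vec" where "a = facet_normal s"
  define c where "c j = (if j = CARD('n) then real (s j) else 0) - a j \<bullet> p" for j
  define u where "u j = a j /\<^sub>R c j" for j
  have c: "0 < c j" if "j \<le> CARD('n)" for j
    using stair_interior[of 1] that less
    by (auto simp: interior_lecture_hall_polytope[OF pos] c_def a_def p_def)
  have u_inner: "u j \<bullet> z = (a j \<bullet> z) / c j" for j z
    by (simp add: u_def divide_inverse mult.commute)
  have "(+) (- p) ` lecture_hall_polytope s = {z. \<forall>j\<in>{..CARD('n)}. a j \<bullet> z \<le> c j}"
  proof (rule set_eqI)
    fix z
    have "z \<in> (+) (- p) ` lecture_hall_polytope s \<longleftrightarrow> p + z \<in> lecture_hall_polytope s"
      by (force simp: image_iff)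
    also have "\<dots> \<longleftrightarrow> (\<forall>j\<in>{..CARD('n)}. a j \<bullet> z \<le> c j)"
      unfolding lecture_hall_polytope_halfspaces[OF pos]
      by (simp add: a_def c_def inner_add_right algebra_simps)
    finally show "z \<in> (+) (- p) ` lecture_hall_polytope s \<longleftrightarrow> z \<in> {z. \<forall>j\<in>{..CARD('n)}. a j \<bullet> z \<le> c j}"
      by simp
  qed
  also have "\<dots> = {z. \<forall>j\<in>{..CARD('n)}. u j \<bullet> z \<le> 1}"
    using c by (auto simp: u_inner)
  finally have Q: "(+) (- p) ` lecture_hall_polytope s = {z. \<forall>j\<in>{..CARD('n)}. u j \<bullet> z \<le> 1}" .
  have "\<exists>j\<in>{..CARD('n)}. 0 \<le> u j \<bullet> z" for z
    using facet_normal_not_all_neg[OF pos, of z] c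
    by (force simp: u_inner a_def zero_le_divide_iff)
  then have dual: "dual_polytope ((+) (- p) ` lecture_hall_polytope s) = convex hull (u ` {..CARD('n)})"
    unfolding Q by (intro dual_polytope_halfspaces) auto
  have "\<exists>z. 0 < u j \<bullet> z \<and> (\<forall>l\<in>{..CARD('n)} - {j}. u l \<bullet> z \<le> 0)" if j: "j \<in> {..CARD('n)}" for j
  proof -
    obtain z :: "(real, 'n) vec" where z: "0 < a j \<bullet> z" "\<And>l. l \<in> {..CARD('n)} - {j} \<Longrightarrow> a l \<bullet> z \<le> 0"
      using facet_normal_separating[OF pos, of j] j unfolding a_def by auto
    have "u l \<bullet> z \<le> 0" if "l \<in> {..CARD('n)} - {j}" for l
      using z(2)[OF that] c[of l] that by (simp add: u_inner divide_le_0_iff)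
    moreover have "0 < u j \<bullet> z"
      using z(1) c[of j] j by (simp add: u_inner)
    ultimately show ?thesis
      by blast
  qed
  then have "lattice_polytope (convex hull (u ` {..CARD('n)})) \<longleftrightarrow> u ` {..CARD('n)} \<subseteq> integer_lattice"
    by (intro lattice_polytope_convex_hull_iff) auto
  moreover have "u = dual_vertex"
    by (auto simp: u_def c_def a_def p_def dual_vertex_def)
  ultimately show ?thesis
    using dual by (auto simp: p_def)
qed

lemma facet_distance:
  assumes s1: "s 1 = i + 1" and j: "j \<le> CARD('n)"
  shows "(if j = CARD('n) then real (s j) else 0) - facet_normal s j \<bullet> (stair s i 1 :: (real, 'n) vec) =
    real (if j = 0 \<or> j = CARD('n) then 1 else if j < i then s j else s (j + 1) - s j)"
proof -
  consider "j = 0" | "j = CARD('n)" "j \<noteq> 0" | "j \<noteq> 0" "j < i" "j < CARD('n)"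
    | "j \<noteq> 0" "i \<le> j" "j < CARD('n)"
    using j by atomize_elim auto
  then show ?thesis
  proof cases
    case 1
    then show ?thesis
      using i by (simp add: inner_facet_normal stair_idx)
  next
    case 2
    then show ?thesis
      using i s1 s_const[of j] by (auto simp: inner_facet_normal stair_idx)
  next
    case 3
    then show ?thesis
      using s_const[of j] s_const[of "j + 1"]
      by (simp add: inner_facet_normal stair_idx algebra_simps)
  next
    case 4
    \<comment> \<open>By \<open>s 1 = i + 1\<close> the \<open>i\<close>-th entry of the point is
      also \<open>s i - 1\<close>, so \<open>j = i\<close> follows the same formula as
      \<open>j > i\<close>.\<close>
    have "s i = i + 1" "s j < s (j + 1)"
      using s_const[of i] i s1 incr 4 by auto
    then show ?thesis
      using 4 by (auto simp: inner_facet_normal stair_idx of_nat_diff algebra_simps)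
  qed
qed

text \<open>For \<open>0 < j < i\<close> the two entries of the normal are \<open>s j\<close> and
  \<open>- s j\<close>, and the distance is also \<open>s j\<close>, so the factor cancels.\<close>

lemma dual_vertex_eq_axis:
  assumes s1: "s 1 = i + 1" and j: "j < i \<or> j = CARD('n)"
  shows "dual_vertex j =
    (if j = 0 then - axis (idx 1) 1 else if j = CARD('n) then axis (idx j) 1
     else axis (idx j) 1 - axis (idx (j + 1)) 1)"
proof -
  have "j \<le> CARD('n)"
    using j i by auto
  then have D: "dual_vertex j = facet_normal s j /\<^sub>R real (if j = 0 \<or> j = CARD('n) then 1 else s j)"
    using j unfolding dual_vertex_def facet_distance[OF s1 \<open>j \<le> CARD('n)\<close>] by auto
  have "s (j + 1) = s j" "0 < s j" if "j \<noteq> 0" "j < i"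
    using that s_const[of j] s_const[of "j + 1"] pos i by auto
  then show ?thesis
    using j unfolding D by (auto simp: facet_normal_def scaleR_diff_right)
qed

lemma dual_vertex_eq:
  assumes s1: "s 1 = i + 1" and j: "i \<le> j" "j < CARD('n)"
  shows "dual_vertex j =
    (real (s (j + 1)) / real (s (j + 1) - s j)) *\<^sub>R axis (idx j) 1
    - (real (s j) / real (s (j + 1) - s j)) *\<^sub>R axis (idx (j + 1)) 1"
proof -
  have D: "dual_vertex j = facet_normal s j /\<^sub>R real (s (j + 1) - s j)"
    using i j facet_distance[OF s1, of j] by (simp add: dual_vertex_def)
  show ?thesis
    using i j unfolding D by (simp add: facet_normal_def scaleR_diff_right divide_inverse_commute)
qed

lemma dual_vertex_lattice_iff:
  assumes s1: "s 1 = i + 1" and j: "i \<le> j" "j < CARD('n)"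
  shows "dual_vertex j \<in> integer_lattice \<longleftrightarrow>
    s (j + 1) - s j dvd s j \<and> s (j + 1) - s j dvd s (j + 1)"
proof -
  define k where "k = s (j + 1) - s j"
  have k: "0 < k"
    using incr j by (simp add: k_def)
  \<comment> \<open>Positivity of \<open>k\<close> matters: division by 0 would give the integer 0
    for every \<open>m\<close>.\<close>
  have frac: "real m / real k \<in> \<int> \<longleftrightarrow> k dvd m" for m
    using k of_nat_dvd_iff by (auto simp: of_int_div_of_int_in_Ints_iff[of "int m" "int k", simplified])
  \<comment> \<open>Distinct axes ensure that the two coefficients are themselves coordinates of the
    vertex.\<close>
  have ne: "(idx j :: 'n) \<noteq> idx (j + 1)"
    using idx_less[of j "j + 1", where 'n = 'n] i j by simp
  have v: "dual_vertex j = (real (s (j + 1)) / real k) *\<^sub>R axis (idx j :: 'n) 1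
      - (real (s j) / real k) *\<^sub>R axis (idx (j + 1)) 1"
    using dual_vertex_eq[OF s1 j] by (simp add: k_def)
  have "dual_vertex j \<in> integer_lattice \<longleftrightarrow>
      real (s (j + 1)) / real k \<in> \<int> \<and> real (s j) / real k \<in> \<int>"
  proof
    assume "dual_vertex j \<in> integer_lattice"
    then have "dual_vertex j $ idx j \<in> \<int>" "dual_vertex j $ idx (j + 1) \<in> \<int>"
      by (auto simp: integer_lattice_def)
    then show "real (s (j + 1)) / real k \<in> \<int> \<and> real (s j) / real k \<in> \<int>"
      using ne by (simp add: v axis_def)
  qed (auto simp: v integer_lattice_def axis_def)
  then show ?thesis
    unfolding frac by (auto simp: k_def)
qed

lemma dual_vertices_lattice_iff:
  assumes s1: "s 1 = i + 1"
  shows "(\<forall>j\<le>CARD('n). dual_vertex j \<in> integer_lattice) \<longleftrightarrow>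
    (\<forall>j. i \<le> j \<and> j < CARD('n) \<longrightarrow> s (j + 1) - s j dvd s j \<and> s (j + 1) - s j dvd s (j + 1))"
proof -
  have "dual_vertex j \<in> integer_lattice" if "j < i \<or> j = CARD('n)" for j
    unfolding dual_vertex_eq_axis[OF s1 that] by (auto simp: integer_lattice_def axis_def)
  then show ?thesis
    using dual_vertex_lattice_iff[OF s1] by (meson le_neq_implies_less less_imp_le not_le)
qed

end

section \<open>The characterization of reflexivity\<close>

theorem theorem2p6:
  fixes s :: "nat \<Rightarrow> nat" and i :: nat
  defines "P \<equiv> (lecture_hall_polytope s :: (real ^ 'n::{finite,linorder}) set)"
  assumes pos: "\<forall>j. 1 \<le> j \<and> j \<le> CARD('n) \<longrightarrow> 0 < s j"
    and i: "1 \<le> i" "i \<le> CARD('n)"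
    and const: "\<forall>j. 1 \<le> j \<and> j \<le> i \<longrightarrow> s j = s 1"
    and incr: "\<forall>j. i \<le> j \<and> j < CARD('n) \<longrightarrow> s j < s (j + 1)"
    and fano: "\<exists>Q. fano Q \<and> translation_equivalent P Q"
  shows "reflexive_up_to_translation P \<longleftrightarrow>
    (\<forall>j. i \<le> j \<and> j < CARD('n) \<longrightarrow>
       (let k = s (j + 1) - s j in k dvd s j \<and> k dvd s (j + 1)))"
proof -
  let ?p = "stair s i 1 :: (real, 'n) vec"
  note facts = pos i const incr
  obtain v where v: "v \<in> integer_lattice" "fano ((+) v ` P)" "translation_equivalent P ((+) v ` P)"
    using fano by (auto simp: translation_equivalent_def)
  have vp: "v = - ?p" and s1: "s 1 = i + 1"
    using fano_translate_lecture_hall[OF facts v(1)] v(2) by (simp_all add: P_def)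
  \<comment> \<open>A reflexive translate is Fano, hence the translate by \<open>- ?p\<close>.
    Conversely, that translate is Fano by assumption, which leaves only the condition on its
    dual.\<close>
  have "reflexive_up_to_translation P \<longleftrightarrow> lattice_polytope (dual_polytope ((+) (- ?p) ` P))"
  proof
    assume "reflexive_up_to_translation P"
    then obtain w where "w \<in> integer_lattice" "reflexive ((+) w ` P)"
      by (auto simp: reflexive_up_to_translation_def translation_equivalent_def)
    then show "lattice_polytope (dual_polytope ((+) (- ?p) ` P))"
      using fano_translate_lecture_hall(1)[OF facts, of w] by (simp add: P_def reflexive_def)
  next
    assume "lattice_polytope (dual_polytope ((+) (- ?p) ` P))"
    then show "reflexive_up_to_translation P"
      using v(2,3) by (auto simp: reflexive_up_to_translation_def reflexive_def vp)
  qed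
  also have "\<dots> \<longleftrightarrow> (\<forall>j. i \<le> j \<and> j < CARD('n) \<longrightarrow>
      s (j + 1) - s j dvd s j \<and> s (j + 1) - s j dvd s (j + 1))"
    using lattice_dual_lecture_hall_iff[OF facts] dual_vertices_lattice_iff[OF facts] s1
    by (simp add: P_def)
  finally show ?thesis
    by (simp add: Let_def)
qed

end
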